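(* For any games $G, H, \widehat{H} \in \widetilde{\mathbb{G}}$, we have $$\mathcal{V}(G :_{\widehat{H}} H) = \bigl(\mathcal{V}(G) + \operatorname{mex}\mathcal{V}(\widehat{H})\bigr) : \mathcal{V}(H),$$ where the colon on the right-hand side is the operation $A : B$ on finite subsets of $\mathbb{Z}_{\geq 0}$.
   Context: Impartial games: set $\widetilde{\mathbb{G}}_0 = \{\emptyset\}$ and $\widetilde{\mathbb{G}}_n = 2^{\widetilde{\mathbb{G}}_{n-1}}$ (power set) for $n \geq 1$, and $\widetilde{\mathbb{G}} = \bigcup_{n \in \mathbb{Z}_{\geq 0}} \widetilde{\mathbb{G}}_n$. Elements of $\widetilde{\mathbb{G}}$ are called games; the elements of a game $G$ are its options. Ordinal sum with substitution: for $G, H, \widehat{H} \in \widetilde{\mathbb{G}}$, the game $G :_{\widehat{H}} H$ is defined recursively by $$G :_{\widehat{H}} H = \{ G' :_{\widehat{H}} \widehat{H} \mid G' \in G\} \cup \{ G :_{\widehat{H}} H' \mid H' \in H \}.$$ For $A \subsetneq \mathbb{Z}_{\geq 0}$, $\operatorname{mex} A = \min(\mathbb{Z}_{\geq 0} \setminus A)$. The Grundy number is defined recursively by $\mathcal{G}(G) = \operatorname{mex}\{\mathcal{G}(G') \mid G' \in G\}$. The variation set of $G$ is $\mathcal{V}(G) = \{\mathcal{G}(G') \mid G' \in G\}$ (a finite subset of $\mathbb{Z}_{\geq 0}$). For $A \subseteq \mathbb{Z}_{\geq 0}$ and $x \in \mathbb{Z}_{\geq 0}$, $A + x = \{a + x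 \mid a \in A\}$. For finite sets $A, B \subseteq \mathbb{Z}_{\geq 0}$, $A : B = A \cup \{x_i \mid i \in B\}$, where $\mathbb{Z}_{\geq 0} \setminus A = \{x_0, x_1, x_2, \ldots\}$ with $x_0 < x_1 < x_2 < \cdots$. *)

theory Defs
  imports "HOL-Library.FSet" "HOL-Library.Infinite_Set"
begin

text \<open>
  Impartial games are the hereditarily finite sets: every game is the finite set of its options,
  and two games with the same options are equal. The datatype below is this type; the lemma
  \<open>game_tower\<close> confirms that it is exhausted by the tower of iterated power sets
  starting from the set containing only the empty game.
\<close>

datatype game = Game (options: "game fset")

primrec game_level :: "nat \<Rightarrow> game set" where
  "game_level 0 = {Game {||}}"
| "game_level (Suc n) = {G. fset (options G) \<subseteq> game_level n}"

lemma game_level_mono: "m \<le> n \<Longrightarrow> game_level m \<subseteq> game_level n"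
proof -
  have step: "game_level n \<subseteq> game_level (Suc n)" for n
    by (induction n) auto
  show "m \<le> n \<Longrightarrow> game_level m \<subseteq> game_level n"
    by (rule lift_Suc_mono_le[of game_level, OF step])
qed

lemma game_tower: "(\<Union>n. game_level n) = UNIV"
proof -
  have "\<exists>n. G \<in> game_level n" for G
  proof (induction G)
    case (Game S)
    then obtain f where f: "\<And>G'. G' |\<in>| S \<Longrightarrow> G' \<in> game_level (f G')"
      by metis
    have "G' \<in> game_level (Max (f ` fset S))" if "G' |\<in>| S" for G'
      using f[OF that] game_level_mono[of "f G'" "Max (f ` fset S)"] that by auto
    then have "Game S \<in> game_level (Suc (Max (f ` fset S)))"
      by auto
    then show ?case ..
  qed
  then show ?thesis by auto
qed

text \<open>
  \<open>ordinal_sum Hh G H\<close> is the ordinal sum of \<open>G\<close> and \<open>H\<close> with substitution \<open>Hh\<close>. A move in the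
  base \<open>G\<close> resets the subordinate to \<open>Hh\<close>, so the recursion descends lexicographically.
\<close>

function ordinal_sum :: "game \<Rightarrow> game \<Rightarrow> game \<Rightarrow> game" where
  "ordinal_sum Hh G H =
     Game ((\<lambda>G'. ordinal_sum Hh G' Hh) |`| options G |\<union>|
           (\<lambda>H'. ordinal_sum Hh G H') |`| options H)"
  by pat_completeness auto
termination
proof -
  have size_option: "size G' < size G" if "G' |\<in>| options G" for G G' :: game
  proof (cases G)
    case (Game S)
    with that have "G' \<in> fset S" by simp
    then have "Suc (size G') \<le> (\<Sum>x\<in>fset S. Suc (size x))"
      by (intro member_le_sum) auto
    with Game show ?thesis by simp
  qed
  show ?thesis
    by (relation "inv_image (measure size <*lex*> measure size) (\<lambda>(Hh, G, H). (G, H))")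
      (auto intro: size_option)
qed

declare ordinal_sum.simps [simp del]

text \<open>Only meaningful for proper subsets of the natural numbers.\<close>

definition mex :: "nat set \<Rightarrow> nat"
  where "mex A = (LEAST n. n \<notin> A)"

primrec grundy :: "game \<Rightarrow> nat"
  where "grundy (Game S) = mex (fset (grundy |`| S))"

definition variation_set :: "game \<Rightarrow> nat set"
  where "variation_set G = grundy ` fset (options G)"

lemma grundy_eq_mex_variation_set: "grundy G = mex (variation_set G)"
  by (cases G) (simp add: variation_set_def)

definition shift_set :: "nat set \<Rightarrow> nat \<Rightarrow> nat set"
  where "shift_set A x = (\<lambda>a. a + x) ` A"

text \<open>
  For finite \<open>A\<close> the complement \<open>- A\<close> is infinite, and \<open>enumerate (- A)\<close> lists it in increasing
  order, starting with index \<open>0\<close>.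
\<close>

definition set_ordinal_sum :: "nat set \<Rightarrow> nat set \<Rightarrow> nat set"
  where "set_ordinal_sum A B = A \<union> enumerate (- A) ` B"

end

theory Submission
  imports Defs
begin

text \<open>
  For finite \<open>A\<close> and \<open>B\<close>, the mex of \<open>A : B\<close> is the entry of the complement of \<open>A\<close> with index
  \<open>mex B\<close>. By induction this determines the Grundy number of \<open>G :\<^sub>K H\<close>. When \<open>H = K\<close> with Grundy
  number \<open>m\<close>, the numbers below \<open>m\<close> are all missing from \<open>\<V>(G) + m\<close>, so the missing number with
  index \<open>m\<close> is the smallest one that is at least \<open>m\<close>, which is \<open>\<G>(G) + m\<close>. Hence the moves in the
  base contribute exactly \<open>\<V>(G) + m\<close>, and the moves in the subordinate contribute the entries of
  its complement with index in \<open>\<V>(H)\<close>.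
\<close>

lemma mex_eqI:
  assumes "n \<notin> A" and "\<And>k. k < n \<Longrightarrow> k \<in> A"
  shows "mex A = n"
  unfolding mex_def using assms by (intro Least_equality) (auto simp: not_less[symmetric])

lemma mex_notin:
  assumes "finite A"
  shows "mex A \<notin> A"
proof -
  obtain n where "n \<notin> A"
    using ex_new_if_finite[OF infinite_UNIV_nat assms] by blast
  then show ?thesis
    unfolding mex_def by (rule LeastI)
qed

lemma less_mex_in: "k < mex A \<Longrightarrow> k \<in> A"
  unfolding mex_def using not_less_Least by blast

lemma infinite_Compl_nat: "finite A \<Longrightarrow> infinite (- A)" for A :: "nat set"
  by (simp add: Compl_eq_Diff_UNIV)

text \<open>Since \<open>enumerate S\<close> is increasing and onto \<open>S\<close>, the elements
  below its entry of index \<open>i\<close> are the \<open>i\<close> earlier entries, so counting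
  them recovers the index.\<close>

lemma enumerate_eqI:
  fixes S :: "nat set"
  assumes "infinite S" "s \<in> S" "card {x \<in> S. x < s} = n"
  shows "enumerate S n = s"
proof -
  obtain i where s: "s = enumerate S i"
    using enumerate_Ex assms(1,2) by metis
  have "{x \<in> S. x < s} = enumerate S ` {..<i}"
    using assms(1) enumerate_Ex[of S]
    by (fastforce simp: s enumerate_in_set enumerate_mono_iff)
  moreover have "inj_on (enumerate S) {..<i}"
    using assms(1) strict_mono_enumerate strict_mono_imp_inj_on by (blast intro: inj_on_subset)
  ultimately have "i = n"
    using assms(3) by (simp add: card_image)
  with s show ?thesis by simp
qed

lemma enumerate_Compl_shift_set_mex:
  assumes "finite A"
  shows "enumerate (- shift_set A m) m = mex A + m"
proof (rule enumerate_eqI)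
  show "infinite (- shift_set A m)"
    using assms by (intro infinite_Compl_nat) (simp add: shift_set_def)
  show "mex A + m \<in> - shift_set A m"
    using mex_notin[OF assms] by (auto simp: shift_set_def)
  \<comment> \<open>From \<open>m\<close> up to \<open>mex A + m\<close>, exclusive, every number is
    the shift of one below \<open>mex A\<close>, hence of an element of \<open>A\<close>.\<close>
  have "x < m" if "x \<notin> shift_set A m" "x < mex A + m" for x
  proof (rule ccontr)
    assume "\<not> x < m"
    then have "x - m \<in> A" "x = (x - m) + m"
      using that(2) by (auto intro: less_mex_in)
    then show False
      using that(1) unfolding shift_set_def by blast
  qed
  then have "{x \<in> - shift_set A m. x < mex A + m} = {..<m}"
    by (auto simp: shift_set_def)
  then show "card {x \<in> - shift_set A m. x < mex A + m} = m" by simp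
qed

lemma mex_set_ordinal_sum:
  assumes "finite A" "finite B"
  shows "mex (set_ordinal_sum A B) = enumerate (- A) (mex B)"
proof (rule mex_eqI)
  note inf = infinite_Compl_nat[OF assms(1)]
  have "inj (enumerate (- A))"
    using inf strict_mono_enumerate strict_mono_imp_inj_on by blast
  then show "enumerate (- A) (mex B) \<notin> set_ordinal_sum A B"
    using enumerate_in_set[OF inf, of "mex B"] mex_notin[OF assms(2)]
    by (auto simp: set_ordinal_sum_def dest: injD)
  fix k assume k: "k < enumerate (- A) (mex B)"
  show "k \<in> set_ordinal_sum A B"
  proof (cases "k \<in> A")
    case False
    then obtain i where i: "enumerate (- A) i = k"
      using enumerate_Ex[of "- A"] inf by auto
    \<comment> \<open>Strict monotonicity of the enumeration turns \<open>k\<close> into the bound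
      \<open>i < mex B\<close>.\<close>
    with k have "i \<in> B"
      using inf by (auto simp: enumerate_mono_iff intro: less_mex_in)
    with i show ?thesis
      by (auto simp: set_ordinal_sum_def)
  qed (simp add: set_ordinal_sum_def)
qed

lemma finite_variation_set: "finite (variation_set G)"
  by (simp add: variation_set_def)

lemma finite_shift_set: "finite A \<Longrightarrow> finite (shift_set A x)"
  by (simp add: shift_set_def)

lemma variation_set_ordinal_sum:
  "variation_set (ordinal_sum Hh G H) =
     (\<lambda>G'. grundy (ordinal_sum Hh G' Hh)) ` fset (options G) \<union>
     (\<lambda>H'. grundy (ordinal_sum Hh G H')) ` fset (options H)"
  unfolding variation_set_def
  by (subst ordinal_sum.simps) (simp add: image_Un image_image)

theorem theorem3p6:
  fixes G H Hh :: game
  shows "variation_set (ordinal_sum Hh G H) =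
         set_ordinal_sum (shift_set (variation_set G) (mex (variation_set Hh))) (variation_set H)"
proof (induction Hh G H rule: ordinal_sum.induct)
  case (1 Hh G H)
  \<comment> \<open>After a base move the subordinate is \<open>Hh\<close> itself, so index and
    shift agree and the entry is explicit.\<close>
  have base: "grundy (ordinal_sum Hh G' Hh) = grundy G' + mex (variation_set Hh)"
    if "G' \<in> fset (options G)" for G'
    using "1.IH"(1)[OF that]
    by (simp add: grundy_eq_mex_variation_set mex_set_ordinal_sum enumerate_Compl_shift_set_mex
        finite_variation_set finite_shift_set)
  \<comment> \<open>Here the index \<open>grundy H'\<close> need not equal the shift, so the entry
    stays unevaluated.\<close>
  have subordinate: "grundy (ordinal_sum Hh G H') =
      enumerate (- shift_set (variation_set G) (mex (variation_set Hh))) (grundy H')"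
    if "H' \<in> fset (options H)" for H'
    using "1.IH"(2)[OF that]
    by (simp add: grundy_eq_mex_variation_set mex_set_ordinal_sum
        finite_variation_set finite_shift_set)
  have "(\<lambda>G'. grundy (ordinal_sum Hh G' Hh)) ` fset (options G) =
      shift_set (variation_set G) (mex (variation_set Hh))"
    by (simp add: base shift_set_def variation_set_def image_image cong: image_cong)
  moreover have "(\<lambda>H'. grundy (ordinal_sum Hh G H')) ` fset (options H) =
      enumerate (- shift_set (variation_set G) (mex (variation_set Hh))) ` variation_set H"
    unfolding variation_set_def[of H] image_image by (rule image_cong) (simp_all add: subordinate)
  ultimately show ?case
    by (simp add: variation_set_ordinal_sum set_ordinal_sum_def)
qed

end
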